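(* For fixed $x = 2^a 5^b 7^c \in M_{4,6}$ with $a, b, c \in \mathbb{Z}_{\ge 0}$ and $a \ge 1$, we have, as functions of $n \ge 1$, \[ \ell_\infty^m(x^n) \in \Theta(n) \qquad \text{and} \qquad \ell_1^m(x^n) \in \Theta(n). \]
   Context: $M_{4,6} = \{1\} \cup \{n \in \mathbb{Z}_{\ge 1} : n \equiv 4 \bmod 6\}$, a multiplicative submonoid of $\mathbb{Z}_{\ge 1}$ (an arithmetical congruence monoid). An atom of $M_{4,6}$ is an irreducible element: an element $u \ne 1$ of $M_{4,6}$ that is not a product of two elements of $M_{4,6} \setminus \{1\}$. For $x \in M_{4,6}$, the set of factorization tuples of $x$ is $\mathsf{Z}(x) = \{\mathbf{z} \in \mathbb{Z}_{\ge 0}^k : x = u_1^{z_1} \cdots u_k^{z_k} \text{ for some } k \ge 0 \text{ and distinct atoms } u_1, \ldots, u_k \in M_{4,6}\}$. For a tuple $\mathbf{z} = (z_1, \ldots, z_k)$, let $\ell_1(\mathbf{z}) = z_1 + \cdots + z_k$ and $\ell_\infty(\mathbf{z}) = \max(z_1, \ldots, z_k)$. For $p \in \{1, \infty\}$, let $\ell_p^m(x) = \min\{\ell_p(\mathbf{z}) : \mathbf{z} \in \mathsf{Z}(x)\}$ (the superscript $m$ stands for minimum and is not an exponent). *)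

theory Defs
  imports Complex_Main "HOL-Number_Theory.Cong" "HOL-Library.Landau_Symbols"
begin

definition M46 :: "nat set" where
  "M46 = {1} \<union> {n. n \<ge> 1 \<and> [n = 4] (mod 6)}"

text \<open>Irreducibility is relative to the monoid \<open>M46\<close>, not to the natural numbers, so the
  library's type-class predicate \<open>irreducible\<close> does not apply.\<close>

definition atoms46 :: "nat set" where
  "atoms46 = {u \<in> M46. u \<noteq> 1 \<and> \<not> (\<exists>v \<in> M46 - {1}. \<exists>w \<in> M46 - {1}. u = v * w)}"

text \<open>Tuples of arbitrary length \<open>k \<ge> 0\<close> are lists; zero entries are allowed.\<close>

definition fact_tuples :: "nat \<Rightarrow> nat list set" where
  "fact_tuples x = {z. \<exists>us. length us = length z \<and> distinct us \<and> set us \<subseteq> atoms46 \<and>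
     x = (\<Prod>i<length z. (us ! i) ^ (z ! i))}"

definition ell_1 :: "nat list \<Rightarrow> nat" where
  "ell_1 z = sum_list z"

text \<open>The inserted \<open>0\<close> only fixes the value on the empty tuple, which is a factorization
  of \<open>1\<close> alone.\<close>

definition ell_inf :: "nat list \<Rightarrow> nat" where
  "ell_inf z = Max (insert 0 (set z))"

definition ell_1_min :: "nat \<Rightarrow> nat" where
  "ell_1_min x = (LEAST l. l \<in> ell_1 ` fact_tuples x)"

definition ell_inf_min :: "nat \<Rightarrow> nat" where
  "ell_inf_min x = (LEAST l. l \<in> ell_inf ` fact_tuples x)"

end

theory Submission
  imports Defs "HOL-Library.Multiset"
begin

text \<open>
  An atom of \<open>M46\<close> is not divisible by 8, because 4 would split off; since \<open>x\<close> is even,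
  a factorization of \<open>x ^ n\<close> thus has at least \<open>n / 2\<close> factors counted with multiplicity.
  By size, at most \<open>n / 4\<close> of them are \<open>\<ge> x ^ 4\<close>. The remaining \<open>n / 4\<close> factors are shared
  among fewer than \<open>x ^ 4\<close> different atoms, so one of these is repeated a linear number of
  times. The upper bounds come from the \<open>n\<close>-th power of a single factorization of \<open>x\<close>.
\<close>

lemma M46_iff: "n \<in> M46 \<longleftrightarrow> n = 1 \<or> n mod 6 = 4"
  by (auto simp: M46_def cong_def)

lemma M46_even: "n \<in> M46 \<Longrightarrow> n \<noteq> 1 \<Longrightarrow> even n"
  unfolding M46_iff by presburger

lemma atoms46_gt_1: "u \<in> atoms46 \<Longrightarrow> u > 1"
  by (cases u) (auto simp: atoms46_def M46_iff)

lemma atoms46_not_8_dvd: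
  assumes "u \<in> atoms46"
  shows "\<not> 8 dvd u"
proof
  assume "8 dvd u"
  then obtain m where m: "u = 8 * m" ..
  have "u mod 6 = 4"
    using assms by (auto simp: atoms46_def M46_iff)
  \<comment> \<open>\<open>8 * m\<close> and \<open>2 * m\<close> differ by \<open>6 * m\<close>, so
    the cofactor left after splitting off 4 stays in the monoid.\<close>
  then have "(2 * m) mod 6 = 4"
    using m mod_mult_self1[of "2 * m" m 6] by simp
  then have "4 \<in> M46 - {1}" "2 * m \<in> M46 - {1}"
    by (auto simp: M46_iff)
  moreover have "u = 4 * (2 * m)"
    using m by simp
  ultimately show False
    using assms unfolding atoms46_def by blast
qed

lemma atoms46_multiplicity_2:
  assumes "u \<in> atoms46"
  shows "multiplicity 2 u \<le> 2"
proof (rule ccontr)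
  assume "\<not> multiplicity 2 u \<le> 2"
  then have "2 ^ 3 dvd u"
    by (intro multiplicity_dvd') simp
  then show False
    using atoms46_not_8_dvd[OF assms] by simp
qed

text \<open>Strong induction: a nontrivial splitting has two smaller factors. With multisets their
  factorizations are joined by a plain sum, whereas tuples would have to merge repeated
  atoms.\<close>

lemma M46_factorization:
  assumes "x \<in> M46"
  shows "\<exists>A. set_mset A \<subseteq> atoms46 \<and> prod_mset A = x"
  using assms
proof (induction x rule: less_induct)
  case (less x)
  consider "x = 1" | "x \<in> atoms46"
    | v w where "v \<in> M46 - {1}" "w \<in> M46 - {1}" "x = v * w"
    using less.prems unfolding atoms46_def by blast
  then show ?case
  proof cases
    case 1
    then show ?thesis by (intro exI[of _ "{#}"]) simp
  next
    case 2
    then show ?thesis by (intro exI[of _ "{#x#}"]) simp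
  next
    case 3
    then have "v > 1" "w > 1"
      by (cases v; cases w; auto simp: M46_iff)+
    then have "v < x" "w < x"
      using 3 by simp_all
    then obtain A B where "set_mset A \<subseteq> atoms46" "prod_mset A = v"
        "set_mset B \<subseteq> atoms46" "prod_mset B = w"
      using less.IH 3 by blast
    then show ?thesis
      using 3 by (intro exI[of _ "A + B"]) auto
  qed
qed

text \<open>The distinct atoms of a multiset factorization are listed, and their multiplicities form
  the tuple. This guarantees that the minima defined by \<open>LEAST\<close> are attained.\<close>

lemma fact_tuples_nonempty:
  assumes "x \<in> M46"
  shows "\<exists>z. z \<in> fact_tuples x"
proof -
  obtain A where A: "set_mset A \<subseteq> atoms46" "prod_mset A = x"
    using M46_factorization[OF assms] by blast
  obtain us where us: "distinct us" "set us = set_mset A"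
    using finite_distinct_list[of "set_mset A"] by auto
  have "x = (\<Prod>u\<in>set us. u ^ count A u)"
    using A us by (simp add: prod_mset_multiplicity)
  also have "\<dots> = (\<Prod>i<length us. (us ! i) ^ count A (us ! i))"
    by (rule prod.reindex_bij_betw[symmetric]) (simp add: bij_betw_nth us)
  finally have "map (count A) us \<in> fact_tuples x"
    using A us unfolding fact_tuples_def by (auto intro!: exI[of _ us])
  then show ?thesis ..
qed

lemma fact_tuples_power:
  assumes "z \<in> fact_tuples x"
  shows "map ((*) n) z \<in> fact_tuples (x ^ n)"
proof -
  obtain us where us: "length us = length z" "distinct us" "set us \<subseteq> atoms46"
      "x = (\<Prod>i<length z. (us ! i) ^ (z ! i))"
    using assms unfolding fact_tuples_def by blast
  have "x ^ n = (\<Prod>i<length z. (us ! i) ^ (n * z ! i))"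
    using us(4) by (simp add: prod_power_distrib mult.commute[of n] flip: power_mult)
  then show ?thesis
    using us(1-3) unfolding fact_tuples_def by (auto intro!: exI[of _ us])
qed

lemma nth_le_ell_inf: "i < length z \<Longrightarrow> z ! i \<le> ell_inf z"
  by (auto simp: ell_inf_def)

lemma ell_inf_le_ell_1: "ell_inf z \<le> ell_1 z"
  by (auto simp: ell_inf_def ell_1_def member_le_sum_list)

lemma power_fact_tuple_lower_bound:
  assumes x: "even x" "x > 0" and z: "z \<in> fact_tuples (x ^ n)"
  shows "n \<le> 4 * x ^ 4 * ell_inf z"
proof -
  obtain us where us: "length us = length z" "distinct us" "set us \<subseteq> atoms46"
      and prod: "x ^ n = (\<Prod>i<length z. (us ! i) ^ (z ! i))"
    using z unfolding fact_tuples_def by blast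
  have atom: "us ! i \<in> atoms46" if "i < length z" for i
    using us that by (metis nth_mem subsetD)
  have gt1: "us ! i > 1" if "i < length z" for i
    using atoms46_gt_1 atom that by blast
  \<comment> \<open>The threshold \<open>x ^ 4\<close> limits the large atoms to half of the
    \<open>n / 2\<close> guaranteed factors; any exponent above 2 would leave a linear share for
    \<open>S\<close>.\<close>
  define L where "L = {i. i < length z \<and> us ! i \<ge> x ^ 4}"
  define S where "S = {i. i < length z \<and> us ! i < x ^ 4}"
  have split: "{..<length z} = L \<union> S" "L \<inter> S = {}" "finite L" "finite S"
    by (auto simp: L_def S_def)

  \<comment> \<open>Factors are counted by 2-adic valuation: it is at least \<open>n\<close> for
    \<open>x ^ n\<close> and at most 2 for each atom.\<close>
  have "n \<le> multiplicity 2 (x ^ n)"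
    using x by (intro multiplicity_geI) (auto intro: dvd_power_same)
  also have "\<dots> = (\<Sum>i<length z. multiplicity 2 ((us ! i) ^ (z ! i)))"
    unfolding prod using gt1
    by (intro prime_elem_multiplicity_prod_distrib) force+
  also have "\<dots> = (\<Sum>i<length z. z ! i * multiplicity 2 (us ! i))"
    using gt1 by (intro sum.cong refl prime_elem_multiplicity_power_distrib) force+
  also have "\<dots> \<le> (\<Sum>i<length z. z ! i * 2)"
    using atom by (intro sum_mono mult_le_mono2 atoms46_multiplicity_2) simp
  finally have total: "n \<le> 2 * (sum ((!) z) L + sum ((!) z) S)"
    using split by (simp add: sum.union_disjoint flip: sum_distrib_right)

  have "x ^ (4 * sum ((!) z) L) = (\<Prod>i\<in>L. (x ^ 4) ^ (z ! i))"
    by (simp add: power_mult power_sum)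
  also have "\<dots> \<le> (\<Prod>i\<in>L. (us ! i) ^ (z ! i))"
    by (intro prod_mono) (auto simp: L_def intro: power_mono)
  \<comment> \<open>The product over \<open>L\<close> divides the full product, which is
    positive.\<close>
  also have "\<dots> \<le> (\<Prod>i<length z. (us ! i) ^ (z ! i))"
    using gt1 by (intro dvd_imp_le prod_dvd_prod_subset prod_pos) (force simp: L_def)+
  also have "\<dots> = x ^ n"
    using prod ..
  finally have large: "4 * sum ((!) z) L \<le> n"
    using x by (subst (asm) power_increasing_iff) auto

  \<comment> \<open>Since \<open>us\<close> is distinct, the small atoms are different numbers below
    \<open>x ^ 4\<close>; each has exponent at most \<open>ell_inf z\<close>.\<close>
  have "card S \<le> card {..<x ^ 4}"
    using us by (intro card_inj_on_le[of "(!) us"] inj_onI) (auto simp: S_def nth_eq_iff_index_eq)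
  then have "sum ((!) z) S \<le> x ^ 4 * ell_inf z"
    using sum_bounded_above[of S "(!) z" "ell_inf z"] nth_le_ell_inf
    by (fastforce simp: S_def intro: order_trans mult_le_mono1)
  \<comment> \<open>By \<open>total\<close> and \<open>large\<close>, \<open>n\<close> is at most
    \<open>n / 2\<close> plus twice the sum over \<open>S\<close>; hence the factor 4.\<close>
  then show ?thesis
    using total large by (simp add: mult.assoc)
qed

lemma ell_inf_min_attained:
  assumes "x \<in> M46"
  obtains z where "z \<in> fact_tuples x" "ell_inf_min x = ell_inf z"
proof -
  have "\<exists>l. l \<in> ell_inf ` fact_tuples x"
    using fact_tuples_nonempty[OF assms] by blast
  then have "ell_inf_min x \<in> ell_inf ` fact_tuples x"
    unfolding ell_inf_min_def by (rule LeastI_ex)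
  then show ?thesis
    using that by blast
qed

lemma ell_1_min_attained:
  assumes "x \<in> M46"
  obtains z where "z \<in> fact_tuples x" "ell_1_min x = ell_1 z"
proof -
  have "\<exists>l. l \<in> ell_1 ` fact_tuples x"
    using fact_tuples_nonempty[OF assms] by blast
  then have "ell_1_min x \<in> ell_1 ` fact_tuples x"
    unfolding ell_1_min_def by (rule LeastI_ex)
  then show ?thesis
    using that by blast
qed

lemma ell_inf_min_le: "z \<in> fact_tuples x \<Longrightarrow> ell_inf_min x \<le> ell_inf z"
  unfolding ell_inf_min_def by (intro Least_le imageI)

lemma ell_1_min_le: "z \<in> fact_tuples x \<Longrightarrow> ell_1_min x \<le> ell_1 z"
  unfolding ell_1_min_def by (intro Least_le imageI)

text \<open>The residue 4 is idempotent modulo 6; exponent 0 gives the identity 1.\<close>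

lemma M46_power: "x \<in> M46 \<Longrightarrow> x ^ n \<in> M46"
proof (induction n)
  case (Suc n)
  have "(x * x ^ n) mod 6 = (x mod 6) * (x ^ n mod 6) mod 6"
    by (simp add: mod_mult_eq)
  with Suc show ?case
    by (auto simp: M46_iff)
qed (simp add: M46_iff)

text \<open>Lets one lower bound, for \<open>ell_inf_min\<close>, and one upper bound, for
  \<open>ell_1_min\<close>, serve both functions.\<close>

lemma ell_inf_min_le_ell_1_min:
  assumes "x \<in> M46"
  shows "ell_inf_min x \<le> ell_1_min x"
proof -
  obtain z where "z \<in> fact_tuples x" "ell_1_min x = ell_1 z"
    using ell_1_min_attained[OF assms] .
  then show ?thesis
    using ell_inf_min_le[of z x] ell_inf_le_ell_1[of z] by simp
qed

lemma ell_1_min_power_le: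
  assumes "x \<in> M46"
  shows "ell_1_min (x ^ n) \<le> n * ell_1_min x"
proof -
  obtain z where z: "z \<in> fact_tuples x" "ell_1_min x = ell_1 z"
    using ell_1_min_attained[OF assms] .
  have "ell_1_min (x ^ n) \<le> ell_1 (map ((*) n) z)"
    by (intro ell_1_min_le fact_tuples_power z)
  then show ?thesis
    by (simp add: z ell_1_def sum_list_const_mult)
qed

lemma ell_inf_min_power_ge:
  assumes "x \<in> M46" "x \<noteq> 1"
  shows "n \<le> 4 * x ^ 4 * ell_inf_min (x ^ n)"
proof -
  have "even x" "x > 0"
    using assms M46_even by (auto simp: M46_def)
  moreover obtain z where "z \<in> fact_tuples (x ^ n)" "ell_inf_min (x ^ n) = ell_inf z"
    using ell_inf_min_attained[OF M46_power[OF assms(1)]] .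
  ultimately show ?thesis
    using power_fact_tuple_lower_bound by simp
qed

text \<open>Both bounds are inequalities over \<open>nat\<close> for every \<open>n\<close>, 0
  included, so neither division nor an eventual threshold enters.\<close>

lemma bigtheta_linearI:
  fixes f :: "nat \<Rightarrow> nat"
  assumes "\<And>n. f n \<le> n * C" and "\<And>n. n \<le> D * f n"
  shows "(\<lambda>n. real (f n)) \<in> \<Theta>(\<lambda>n. real n)"
proof (rule bigthetaI)
  show "(\<lambda>n. real (f n)) \<in> O(\<lambda>n. real n)"
    using assms(1)
    by (intro bigoI[of _ "real C"] always_eventually allI)
       (simp add: mult.commute flip: of_nat_mult)
  show "(\<lambda>n. real (f n)) \<in> \<Omega>(\<lambda>n. real n)"
    unfolding bigomega_iff_bigo using assms(2)
    by (intro bigoI[of _ "real D"] always_eventually allI) (simp flip: of_nat_mult)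
qed

theorem theorem3p5:
  fixes x a b c :: nat
  assumes "x = 2 ^ a * 5 ^ b * 7 ^ c"
    and "x \<in> M46"
    and "a \<ge> 1"
  shows "(\<lambda>n::nat. real (ell_inf_min (x ^ n))) \<in> \<Theta>(\<lambda>n. real n) \<and>
         (\<lambda>n::nat. real (ell_1_min (x ^ n))) \<in> \<Theta>(\<lambda>n. real n)"
proof -
  have "even x"
    using assms(1,3) by simp
  then have "x \<noteq> 1"
    by auto
  note lower = ell_inf_min_power_ge[OF assms(2) this]
  note upper = ell_1_min_power_le[OF assms(2)]
  note between = ell_inf_min_le_ell_1_min[OF M46_power[OF assms(2)]]
  \<comment> \<open>Composing with \<open>between\<close> supplies the upper bound of the first
    claim and the lower bound of the second.\<close>
  show ?thesis
    by (intro conjI bigtheta_linearI[of _ "ell_1_min x" "4 * x ^ 4"] lower upper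
        order_trans[OF between upper] order_trans[OF lower mult_le_mono2[OF between]])
qed

end
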